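(* For the $K_r$-bootstrap percolation process: \begin{itemize} \item for every $n \geq 2$, $\tau_{\max}(n,3) = \lceil \log_2 (n-1) \rceil$; \item for every $n \geq 3$, $\tau_{\max}(n,4) = n-3$; \item for every fixed $r \geq 5$, $\tau_{\max}(n,r) = \Omega(n^{3/2})$ as $n \to \infty$, i.e. there are constants $c=c(r)>0$ and $n_0$ such that $\tau_{\max}(n,r) \geq c\, n^{3/2}$ for all $n \geq n_0$. \end{itemize}
   Context: Fix an integer $r \geq 3$. The $K_r$-bootstrap percolation process on $K_n$ (vertex set $[n]$) is defined as follows: given a set of initially active edges $G \subseteq E(K_n)$ (identified with the graph on $[n]$ with these edges), set $G_0 := G$ and for every integer $t \geq 0$, $G_{t+1} := G_t \cup \{ e \in E(K_n) : \text{there is a copy } H \text{ of } K_r \text{ with } e \in H \subseteq G_t \cup \{e\}\}$, i.e. an edge is added at time $t+1$ if it is the only missing edge of some $r$-clique in $G_t$. Write $\langle G\rangle_t := G_t$ and $\langle G \rangle_{K_r} := \bigcup_{t} G_t$. The saturation time of $G$ is $\tau_r(G) := \min\{t \geq 0 : \langle G \rangle_t = \langle G \rangle_{K_r}\}$, and the maximum saturation time is $\tau_{\max}(n,r) := \max\{\tau_r(G) : G \text{ a graph on } n \text{ vertices}\}$. *)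

theory Defs
  imports Complex_Main
begin

definition Kn_edges :: "nat \<Rightarrow> nat set set" where
  "Kn_edges n = {e. \<exists>u v. u < n \<and> v < n \<and> u \<noteq> v \<and> e = {u, v}}"

definition perc_step :: "nat \<Rightarrow> nat \<Rightarrow> nat set set \<Rightarrow> nat set set" where
  "perc_step r n G = G \<union> {e \<in> Kn_edges n. \<exists>S. S \<subseteq> {..<n} \<and> card S = r \<and> e \<subseteq> S \<and>
       (\<forall>f \<in> Kn_edges n. f \<subseteq> S \<longrightarrow> f \<in> G \<union> {e})}"

definition perc_at :: "nat \<Rightarrow> nat \<Rightarrow> nat set set \<Rightarrow> nat \<Rightarrow> nat set set" where
  "perc_at r n G t = (perc_step r n ^^ t) G"

definition perc_closure :: "nat \<Rightarrow> nat \<Rightarrow> nat set set \<Rightarrow> nat set set" where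
  "perc_closure r n G = (\<Union>t. perc_at r n G t)"

definition sat_time :: "nat \<Rightarrow> nat \<Rightarrow> nat set set \<Rightarrow> nat" where
  "sat_time r n G = (LEAST t. perc_at r n G t = perc_closure r n G)"

definition tau_max :: "nat \<Rightarrow> nat \<Rightarrow> nat" where
  "tau_max n r = Max {sat_time r n G | G. G \<subseteq> Kn_edges n}"

end

(*
  r = 3: an edge is active at time t iff its ends are at distance at most 2^t in G.

  r = 4: by induction on t, an edge that becomes active at time t comes with a clique on at least
  t + 3 vertices to which both its ends are attached; hence the process lasts at most n - 3 steps.

  r >= 5: glue r-cliques H_0, H_1, ... into a chain, consecutive ones sharing an edge e_i, and start
  with all edges but e_1, e_2, ....  If the only r-sets missing at most one edge are the H_i, then
  exactly e_t becomes active at time t.  This holds as soon as all triangles lie inside some H_i,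
  which a greedy choice ensures: the new vertices of H_i are taken at distance at least 3 from the
  old edge and from each other.  With all degrees of order sqrt n, the balls of radius 2 cover only a
  small part of the n vertices, so the chain can be continued for about n^(3/2) steps.
*)
theory Submission
  imports Defs
begin

text \<open>The condition r >= 5 keeps a chain from filling up sideways. For r = 4, a shared edge
  that has become active forms, with one further vertex of each of its two cliques, a 4-set lacking
  a single edge, so edges outside the chain would appear. For larger r, an r-set with one missing
  edge has three vertices off that edge, while two cliques of the chain share at most two.

  The exponent is a balance. If every vertex is in about D cliques, at most about r^2 D^2 vertices
  lie within distance 2 of a given one, so D may be of order sqrt n. On the other hand m cliques use
  up m r incidences; as long as m r <= D n / 2, at least half of the vertices are in fewer than D
  cliques and stay available. This allows m of order D n.

  For r = 3 and r = 4 the matching lower bounds come from explicit starts: a path, and a graph in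
  which each vertex waits for its predecessor.\<close>

section \<open>Edges as two-element sets\<close>

lemma doubleton_in_Kn_edges [simp]: "{u, v} \<in> Kn_edges n \<longleftrightarrow> u < n \<and> v < n \<and> u \<noteq> v"
  by (auto simp: Kn_edges_def doubleton_eq_iff)

lemma in_Kn_edgesE:
  assumes "f \<in> Kn_edges n"
  obtains u v where "f = {u, v}" "u < n" "v < n" "u \<noteq> v"
  using assms by (auto simp: Kn_edges_def)

lemma edge_set_eqI:
  assumes "A \<subseteq> Kn_edges n" "B \<subseteq> Kn_edges n"
    and "\<And>a b. a \<noteq> b \<Longrightarrow> {a, b} \<in> A \<longleftrightarrow> {a, b} \<in> B"
  shows "A = B"
proof (rule set_eqI)
  fix f
  show "f \<in> A \<longleftrightarrow> f \<in> B"
  proof (cases "f \<in> Kn_edges n")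
    case True
    then show ?thesis using assms(3) in_Kn_edgesE by metis
  qed (use assms(1,2) in blast)
qed

lemma finite_Kn_edges: "finite (Kn_edges n)"
proof (rule finite_subset)
  show "Kn_edges n \<subseteq> Pow {..<n}" by (auto simp: Kn_edges_def)
qed simp

lemma perc_step_iff:
  "{a, b} \<in> perc_step r n G \<longleftrightarrow> {a, b} \<in> G \<or>
     (a \<noteq> b \<and> (\<exists>S. S \<subseteq> {..<n} \<and> card S = r \<and> a \<in> S \<and> b \<in> S \<and>
        (\<forall>u\<in>S. \<forall>v\<in>S. u \<noteq> v \<longrightarrow> {u, v} \<in> G \<or> {u, v} = {a, b})))"
proof -
  have "(\<forall>f \<in> Kn_edges n. f \<subseteq> S \<longrightarrow> f \<in> G \<union> {{a, b}}) \<longleftrightarrow>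
        (\<forall>u\<in>S. \<forall>v\<in>S. u \<noteq> v \<longrightarrow> {u, v} \<in> G \<or> {u, v} = {a, b})"
    if S: "S \<subseteq> {..<n}" for S
  proof (intro iffI ballI impI)
    fix u v assume *: "\<forall>f \<in> Kn_edges n. f \<subseteq> S \<longrightarrow> f \<in> G \<union> {{a, b}}" "u \<in> S" "v \<in> S" "u \<noteq> v"
    then have "{u, v} \<in> Kn_edges n" "{u, v} \<subseteq> S" using S by auto
    then show "{u, v} \<in> G \<or> {u, v} = {a, b}" using * by blast
  next
    fix f assume *: "\<forall>u\<in>S. \<forall>v\<in>S. u \<noteq> v \<longrightarrow> {u, v} \<in> G \<or> {u, v} = {a, b}"
      "f \<in> Kn_edges n" "f \<subseteq> S"
    from *(2) obtain u v where "f = {u, v}" "u \<noteq> v" by (rule in_Kn_edgesE)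
    then show "f \<in> G \<union> {{a, b}}" using * by blast
  qed
  then have "{a, b} \<in> perc_step r n G \<longleftrightarrow> {a, b} \<in> G \<or> {a, b} \<in> Kn_edges n \<and>
     (\<exists>S. S \<subseteq> {..<n} \<and> card S = r \<and> {a, b} \<subseteq> S \<and>
        (\<forall>u\<in>S. \<forall>v\<in>S. u \<noteq> v \<longrightarrow> {u, v} \<in> G \<or> {u, v} = {a, b}))"
    unfolding perc_step_def by (simp cong: conj_cong)
  then show ?thesis unfolding doubleton_in_Kn_edges by blast
qed

lemma perc_step_subset: "G \<subseteq> Kn_edges n \<Longrightarrow> perc_step r n G \<subseteq> Kn_edges n"
  by (auto simp: perc_step_def)

section \<open>Monotonicity, stabilisation and saturation time of the process\<close>

lemma perc_at_0 [simp]: "perc_at r n G 0 = G"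
  by (simp add: perc_at_def)

lemma perc_at_Suc: "perc_at r n G (Suc t) = perc_step r n (perc_at r n G t)"
  by (simp add: perc_at_def)

lemma perc_at_subset: "G \<subseteq> Kn_edges n \<Longrightarrow> perc_at r n G t \<subseteq> Kn_edges n"
  by (induction t) (simp_all add: perc_at_Suc perc_step_subset)

lemma perc_at_mono: "s \<le> t \<Longrightarrow> perc_at r n G s \<subseteq> perc_at r n G t"
  by (rule lift_Suc_mono_le) (auto simp: perc_at_Suc perc_step_def)

lemma perc_at_stable:
  assumes "perc_at r n G (Suc t) = perc_at r n G t"
  shows "perc_closure r n G = perc_at r n G t"
proof -
  have "perc_at r n G (t + k) = perc_at r n G t" for k
    using assms by (induction k) (simp_all add: perc_at_Suc)
  then have "perc_at r n G s \<subseteq> perc_at r n G t" for s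
    using perc_at_mono[of s "t + s" r n G] by simp
  then show ?thesis by (auto simp: perc_closure_def)
qed

text \<open>Each step that changes something adds an edge, and there are finitely many. So the
  \<open>LEAST\<close> in \<open>sat_time\<close> ranges over a nonempty set.\<close>

lemma perc_at_eventually_stable:
  assumes "G \<subseteq> Kn_edges n"
  shows "\<exists>t. perc_at r n G (Suc t) = perc_at r n G t"
proof (rule ccontr)
  assume "\<not> ?thesis"
  then have neq: "perc_at r n G (Suc t) \<noteq> perc_at r n G t" for t by auto
  have fin: "finite (perc_at r n G t)" for t
    using perc_at_subset[OF assms] finite_Kn_edges finite_subset by metis
  have "t \<le> card (perc_at r n G t)" for t
  proof (induction t)
    case (Suc t)
    have "perc_at r n G t \<subset> perc_at r n G (Suc t)"
      using neq[of t] perc_at_mono[of t "Suc t" r n G] by auto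
    from psubset_card_mono[OF fin this] Suc show ?case by simp
  qed simp
  from this[of "Suc (card (Kn_edges n))"] show False
    using card_mono[OF finite_Kn_edges perc_at_subset[OF assms, of r]] by (meson not_less_eq_eq order.trans)
qed

lemma perc_at_sat_time:
  assumes "G \<subseteq> Kn_edges n"
  shows "perc_at r n G (sat_time r n G) = perc_closure r n G"
proof -
  obtain t where "perc_at r n G t = perc_closure r n G"
    using perc_at_eventually_stable[OF assms] perc_at_stable by metis
  then show ?thesis unfolding sat_time_def by (rule LeastI)
qed

lemma sat_time_le:
  assumes "perc_at r n G (Suc t) = perc_at r n G t"
  shows "sat_time r n G \<le> t"
  unfolding sat_time_def using perc_at_stable[OF assms] by (intro Least_le) simp

text \<open>The form in which every lower bound is proved: a single late edge \<open>f\<close> of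
  the closure keeps all stages before \<open>m\<close> from being the closure.\<close>

lemma sat_time_ge:
  assumes "G \<subseteq> Kn_edges n" "f \<in> perc_at r n G s" "\<And>t. t < m \<Longrightarrow> f \<notin> perc_at r n G t"
  shows "m \<le> sat_time r n G"
proof (rule ccontr)
  assume "\<not> ?thesis"
  then have "f \<notin> perc_closure r n G"
    using assms(3) perc_at_sat_time[OF assms(1)] by (metis not_le)
  then show False using assms(2) by (auto simp: perc_closure_def)
qed

lemma sat_time_last:
  assumes "sat_time r n G = Suc t"
  shows "\<exists>f. f \<in> perc_at r n G (Suc t) - perc_at r n G t"
proof -
  have "perc_at r n G (Suc t) \<noteq> perc_at r n G t"
    using sat_time_le[of r n G t] assms by auto
  then show ?thesis using perc_at_mono[of t "Suc t" r n G] by auto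
qed

lemma finite_sat_times: "finite {sat_time r n G | G. G \<subseteq> Kn_edges n}"
proof -
  have "{sat_time r n G | G. G \<subseteq> Kn_edges n} = sat_time r n ` Pow (Kn_edges n)" by auto
  then show ?thesis using finite_Kn_edges by simp
qed

lemma tau_max_ge:
  assumes "G \<subseteq> Kn_edges n" "m \<le> sat_time r n G"
  shows "m \<le> tau_max n r"
  unfolding tau_max_def
  by (rule order.trans[OF assms(2)], rule Max_ge[OF finite_sat_times]) (use assms(1) in auto)

lemma tau_max_le:
  assumes "\<And>G. G \<subseteq> Kn_edges n \<Longrightarrow> sat_time r n G \<le> m"
  shows "tau_max n r \<le> m"
  unfolding tau_max_def
  by (rule Max.boundedI[OF finite_sat_times]) (use assms in auto)

subsection \<open>Triangles\<close>

text \<open>Reflexive, so that \<open>reach G ^^ k\<close> means distance at most \<open>k\<close>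
  rather than a walk of length exactly \<open>k\<close>. Numbers outside \<open>{..<n}\<close> are
  related to themselves too.\<close>

definition reach :: "nat set set \<Rightarrow> nat rel" where
  "reach G = {(u, v). u = v \<or> {u, v} \<in> G}"

lemma card_3_subset_eq:
  assumes "card S = 3" "a \<in> S" "b \<in> S" "a \<noteq> b"
  obtains w where "S = {a, b, w}" "w \<noteq> a" "w \<noteq> b"
proof -
  have "finite S" using assms(1) card.infinite by fastforce
  then have "card (S - {a, b}) = 1" using assms by (simp add: card_Diff_subset)
  then obtain w where "S - {a, b} = {w}" by (auto simp: card_1_singleton_iff)
  then show thesis using that[of w] assms by blast
qed

lemma reach_perc_step:
  assumes "G \<subseteq> Kn_edges n"
  shows "reach (perc_step 3 n G) = reach G O reach G"
proof -
  have "(u, v) \<in> reach (perc_step 3 n G) \<longleftrightarrow> (u, v) \<in> reach G O reach G" for u v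
  proof
    assume "(u, v) \<in> reach (perc_step 3 n G)"
    then consider "u = v \<or> {u, v} \<in> G" | "u \<noteq> v" "{u, v} \<notin> G" "{u, v} \<in> perc_step 3 n G"
      by (auto simp: reach_def)
    then show "(u, v) \<in> reach G O reach G"
    proof cases
      case 1
      then show ?thesis by (auto simp: reach_def)
    next
      case 2
      then obtain S where S: "card S = 3" "u \<in> S" "v \<in> S"
        "\<forall>x\<in>S. \<forall>y\<in>S. x \<noteq> y \<longrightarrow> {x, y} \<in> G \<or> {x, y} = {u, v}"
        by (auto simp: perc_step_iff)
      obtain w where "S = {u, v, w}" "w \<noteq> u" "w \<noteq> v"
        using card_3_subset_eq[OF S(1-3) 2(1)] .
      then have "{u, w} \<in> G" "{w, v} \<in> G"
        using S(4) by (auto simp: doubleton_eq_iff)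
      then show ?thesis by (auto simp: reach_def)
    qed
  next
    assume "(u, v) \<in> reach G O reach G"
    then obtain w where w: "(u, w) \<in> reach G" "(w, v) \<in> reach G" by auto
    show "(u, v) \<in> reach (perc_step 3 n G)"
    proof (cases "u = v \<or> (u, v) \<in> reach G")
      case True
      then show ?thesis by (auto simp: reach_def perc_step_def)
    next
      case False
      then have "w \<noteq> u" "w \<noteq> v" using w by auto
      then have e: "{u, w} \<in> G" "{w, v} \<in> G" using w by (auto simp: reach_def)
      have "{u, w} \<in> Kn_edges n" "{w, v} \<in> Kn_edges n" using e assms by blast+
      then have "{u, v, w} \<subseteq> {..<n}" by auto
      moreover have "card {u, v, w} = 3" using False \<open>w \<noteq> u\<close> \<open>w \<noteq> v\<close> by auto
      moreover have "\<forall>x\<in>{u, v, w}. \<forall>y\<in>{u, v, w}. x \<noteq> y \<longrightarrow> {x, y} \<in> G \<or> {x, y} = {u, v}"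
        using e by (auto simp: insert_commute)
      ultimately show ?thesis using False unfolding reach_def
        by (auto simp: perc_step_iff intro!: exI[of _ "{u, v, w}"])
    qed
  qed
  then show ?thesis by auto
qed

lemma reach_perc_at:
  assumes "G \<subseteq> Kn_edges n"
  shows "reach (perc_at 3 n G t) = reach G ^^ (2 ^ t)"
proof (induction t)
  case (Suc t)
  have "(2::nat) ^ Suc t = 2 ^ t + 2 ^ t" by simp
  then show ?case
    using reach_perc_step[OF perc_at_subset[OF assms]] Suc
    by (simp only: perc_at_Suc relpow_add)
qed simp

lemma reach_inject:
  assumes "A \<subseteq> Kn_edges n" "B \<subseteq> Kn_edges n" "reach A = reach B"
  shows "A = B"
proof (rule edge_set_eqI[OF assms(1,2)])
  fix a b :: nat assume "a \<noteq> b"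
  then have "{a, b} \<in> C \<longleftrightarrow> (a, b) \<in> reach C" for C by (simp add: reach_def)
  then show "{a, b} \<in> A \<longleftrightarrow> {a, b} \<in> B" using assms(3) by simp
qed

lemma reachD:
  assumes "G \<subseteq> Kn_edges n" "(u, v) \<in> reach G"
  shows "u = v \<or> u \<in> {..<n} \<and> v \<in> {..<n}"
proof -
  have "u = v \<or> {u, v} \<in> Kn_edges n" using assms unfolding reach_def by blast
  then show ?thesis by auto
qed

lemma relpow_reach_mono: "i \<le> j \<Longrightarrow> reach G ^^ i \<subseteq> reach G ^^ j"
  by (rule lift_Suc_mono_le) (auto simp: reach_def)

text \<open>Balls around \<open>u\<close> grow strictly until they stop for good; growth at every
  radius up to \<open>n - 1\<close> would put \<open>n + 1\<close> vertices into the ball of radius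
  \<open>n\<close>.\<close>

lemma relpow_reach_bounded:
  assumes "G \<subseteq> Kn_edges n"
  shows "reach G ^^ k \<subseteq> reach G ^^ (n - 1)"
proof
  fix p assume "p \<in> reach G ^^ k"
  then obtain u v where p: "p = (u, v)" "(u, v) \<in> reach G ^^ k" by (cases p) auto
  define N where "N j = (reach G ^^ j) `` {u}" for j
  have N_Suc: "N (Suc j) = reach G `` N j" for j
    by (auto simp: N_def)
  have N_mono: "N i \<subseteq> N j" if "i \<le> j" for i j
    using relpow_reach_mono[OF that] by (auto simp: N_def)
  have stable: "N (i + j) = N i" if "N (Suc i) = N i" for i j
    using that by (induction j) (simp_all add: N_Suc)
  \<comment> \<open>\<open>insert u\<close> is there because \<open>reach\<close> relates
    \<open>u\<close> to itself even if \<open>u\<close> is not a vertex.\<close>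
  have N_sub: "N j \<subseteq> insert u {..<n}" for j
  proof (induction j)
    case (Suc j)
    have "reach G `` insert u {..<n} \<subseteq> insert u {..<n}"
      using reachD[OF assms] by blast
    moreover have "N (Suc j) \<subseteq> reach G `` insert u {..<n}"
      using Suc unfolding N_Suc by (rule Image_mono[OF order_refl])
    ultimately show ?case by (rule order.trans[rotated])
  qed (simp add: N_def)
  have "\<exists>i\<le>n - 1. N (Suc i) = N i"
  proof (cases "u < n")
    case False
    have "reach G `` {u} \<subseteq> {u}"
      using reachD[OF assms] False by blast
    then have "N (Suc 0) = N 0" using N_mono[of 0 "Suc 0"] by (auto simp: N_def)
    then show ?thesis by blast
  next
    case True
    show ?thesis
    proof (rule ccontr)
      assume *: "\<not> ?thesis"
      have "j \<le> n \<Longrightarrow> Suc j \<le> card (N j)" for j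
      proof (induction j)
        case (Suc j)
        then have "N (Suc j) \<noteq> N j" using * by auto
        then have "N j \<subset> N (Suc j)" using N_mono[of j "Suc j"] by auto
        moreover have "finite (N (Suc j))" using N_sub finite_subset by blast
        ultimately have "card (N j) < card (N (Suc j))" by (rule psubset_card_mono[rotated])
        then show ?case using Suc by simp
      qed (simp add: N_def)
      from this[of n] show False
        using card_mono[OF _ N_sub[of n]] True by (simp add: insert_absorb)
    qed
  qed
  then obtain i where i: "i \<le> n - 1" "N (Suc i) = N i" by blast
  have "v \<in> N k" using p by (auto simp: N_def)
  also have "N k \<subseteq> N (i + k)" by (rule N_mono) simp
  also have "\<dots> \<subseteq> N (n - 1)" using stable[OF i(2)] N_mono[OF i(1)] by simp
  finally show "p \<in> reach G ^^ (n - 1)" using p by (simp add: N_def)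
qed

lemma sat_time_3_le:
  assumes "G \<subseteq> Kn_edges n" "n - 1 \<le> 2 ^ t"
  shows "sat_time 3 n G \<le> t"
proof (rule sat_time_le, rule reach_inject)
  have "reach G ^^ k = reach G ^^ (n - 1)" if "n - 1 \<le> k" for k
    using relpow_reach_bounded[OF assms(1), of k] relpow_reach_mono[OF that, of G] by blast
  from this[of "2 ^ t"] this[of "2 ^ Suc t"]
  show "reach (perc_at 3 n G (Suc t)) = reach (perc_at 3 n G t)"
    unfolding reach_perc_at[OF assms(1)] using assms(2) by simp
qed (use perc_at_subset[OF assms(1)] in auto)

text \<open>The extremal start is a path: one step raises a vertex number by at most one, so the
  ends \<open>0\<close> and \<open>n - 1\<close> are at distance exactly
  \<open>n - 1\<close>.\<close>

lemma relpow_successor_path: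
  fixes n :: nat
  defines "G \<equiv> {{i, Suc i} | i. Suc i < n}"
  shows "(u, v) \<in> reach G ^^ k \<Longrightarrow> v \<le> u + k" "j < n \<Longrightarrow> (0, j) \<in> reach G ^^ j"
proof -
  show "(u, v) \<in> reach G ^^ k \<Longrightarrow> v \<le> u + k"
  proof (induction k arbitrary: v)
    case (Suc k)
    then obtain w where "(u, w) \<in> reach G ^^ k" "(w, v) \<in> reach G" by auto
    then have "w \<le> u + k" "v \<le> Suc w"
      using Suc.IH by (auto simp: reach_def G_def doubleton_eq_iff)
    then show ?case by simp
  qed simp
  show "j < n \<Longrightarrow> (0, j) \<in> reach G ^^ j"
  proof (induction j)
    case (Suc j)
    then have "(j, Suc j) \<in> reach G" by (auto simp: reach_def G_def)
    then show ?case using Suc by auto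
  qed simp
qed

lemma tau_max_3:
  assumes "2 \<le> n" "n - 1 \<le> 2 ^ T" "\<And>t. t < T \<Longrightarrow> 2 ^ t < n - 1"
  shows "tau_max n 3 = T"
proof (rule antisym)
  show "tau_max n 3 \<le> T" using sat_time_3_le assms(2) by (intro tau_max_le)
  define G where "G = {{i, Suc i} | i. Suc i < n}"
  have G: "G \<subseteq> Kn_edges n" by (auto simp: G_def)
  have "{0, n - 1} \<notin> perc_at 3 n G t" if "t < T" for t
  proof
    assume "{0, n - 1} \<in> perc_at 3 n G t"
    then have "(0, n - 1) \<in> reach G ^^ (2 ^ t)"
      unfolding reach_perc_at[OF G, symmetric] by (simp add: reach_def)
    then have "n - 1 \<le> 2 ^ t" using relpow_successor_path(1) unfolding G_def by fastforce
    then show False using assms(3)[OF that] by simp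
  qed
  moreover have "(0, n - 1) \<in> reach (perc_at 3 n G T)"
    using relpow_successor_path(2)[of "n - 1" n] relpow_reach_mono[OF assms(2), of G] assms(1)
    unfolding reach_perc_at[OF G] by (auto simp: G_def)
  then have "{0, n - 1} \<in> perc_at 3 n G T" using assms(1) by (simp add: reach_def)
  ultimately have "T \<le> sat_time 3 n G" using sat_time_ge[OF G] by blast
  then show "T \<le> tau_max n 3" by (rule tau_max_ge[OF G])
qed

lemma tau_max_3_eq:
  assumes "2 \<le> n"
  shows "int (tau_max n 3) = \<lceil>log 2 (real n - 1)\<rceil>"
proof -
  define T where "T = nat \<lceil>log 2 (real n - 1)\<rceil>"
  have pos: "real n - 1 \<ge> 1" using assms by simp
  then have "0 \<le> log 2 (real n - 1)" by simp
  then have T: "int T = \<lceil>log 2 (real n - 1)\<rceil>"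
    unfolding T_def by (intro nat_0_le) linarith
  have iff: "real n - 1 \<le> 2 ^ t \<longleftrightarrow> T \<le> t" for t
  proof -
    have "real n - 1 \<le> 2 ^ t \<longleftrightarrow> log 2 (real n - 1) \<le> real t"
      using pos by (simp add: log_le_iff powr_realpow)
    also have "\<dots> \<longleftrightarrow> \<lceil>log 2 (real n - 1)\<rceil> \<le> int t" by (simp add: ceiling_le_iff)
    finally show ?thesis unfolding T[symmetric] by simp
  qed
  have iff': "n - 1 \<le> 2 ^ t \<longleftrightarrow> T \<le> t" for t
  proof -
    have "n - 1 \<le> 2 ^ t \<longleftrightarrow> real (n - 1) \<le> real (2 ^ t)" by (rule of_nat_le_iff[symmetric])
    then show ?thesis using iff[of t] assms by (simp add: of_nat_diff)
  qed
  have "tau_max n 3 = T" using assms iff' by (intro tau_max_3) (auto simp: not_le[symmetric])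
  then show ?thesis using T by simp
qed

subsection \<open>Cliques on four vertices\<close>

definition clique :: "nat set set \<Rightarrow> nat set \<Rightarrow> bool" where
  "clique A Q \<longleftrightarrow> (\<forall>x\<in>Q. \<forall>y\<in>Q. x \<noteq> y \<longrightarrow> {x, y} \<in> A)"

definition attached :: "nat set set \<Rightarrow> nat set \<Rightarrow> nat \<Rightarrow> bool" where
  "attached A Q v \<longleftrightarrow> v \<in> Q \<or> (\<exists>x\<in>Q. \<exists>y\<in>Q. x \<noteq> y \<and> {v, x} \<in> A \<and> {v, y} \<in> A)"

lemma clique_mono: "clique A Q \<Longrightarrow> A \<subseteq> B \<Longrightarrow> clique B Q"
  unfolding clique_def by blast

lemma clique_insert:
  "clique A (insert v Q) \<longleftrightarrow> clique A Q \<and> (\<forall>x\<in>Q. x \<noteq> v \<longrightarrow> {v, x} \<in> A)"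
proof
  assume *: "clique A Q \<and> (\<forall>x\<in>Q. x \<noteq> v \<longrightarrow> {v, x} \<in> A)"
  show "clique A (insert v Q)"
    unfolding clique_def
  proof (intro ballI impI)
    fix x y assume "x \<in> insert v Q" "y \<in> insert v Q" "x \<noteq> y"
    then consider "x \<in> Q" "y \<in> Q" | "x = v" "y \<in> Q" | "x \<in> Q" "y = v" by blast
    then show "{x, y} \<in> A"
    proof cases
      case 3
      then show ?thesis using * \<open>x \<noteq> y\<close> by (metis insert_commute)
    qed (use * \<open>x \<noteq> y\<close> in \<open>auto simp: clique_def\<close>)
  qed
qed (auto simp: clique_def)

text \<open>If \<open>v\<close> sees \<open>x\<close> and \<open>y\<close> in \<open>Q\<close>, then
  for every further \<open>z\<close> in \<open>Q\<close> the set \<open>{v, z, x, y}\<close> lacks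
  at most \<open>{v, z}\<close>; all these edges arrive in the same step.\<close>

lemma clique_perc_step_insert:
  assumes A: "A \<subseteq> Kn_edges n" and Q: "Q \<subseteq> {..<n}" "clique A Q" and v: "attached A Q v"
  shows "clique (perc_step 4 n A) (insert v Q)"
proof -
  have sub: "A \<subseteq> perc_step 4 n A" by (auto simp: perc_step_def)
  have "{v, z} \<in> perc_step 4 n A" if z: "z \<in> Q" "z \<noteq> v" for z
  proof (cases "v \<in> Q \<or> {v, z} \<in> A")
    case True
    then have "{v, z} \<in> A" using Q(2) z by (auto simp: clique_def)
    then show ?thesis using sub by (rule subsetD[rotated])
  next
    case False
    then obtain x y where xy: "x \<in> Q" "y \<in> Q" "x \<noteq> y" "{v, x} \<in> A" "{v, y} \<in> A"
      using v by (auto simp: attached_def)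
    then have ne: "v \<noteq> x" "v \<noteq> y" "z \<noteq> x" "z \<noteq> y" using False by auto
    have "{v, x} \<in> Kn_edges n" using xy A by blast
    then have "{v, z, x, y} \<subseteq> {..<n}" using Q z xy by auto
    have "card {v, z, x, y} = 4" using ne xy z by auto
    have "{x, y} \<in> A" "{z, x} \<in> A" "{z, y} \<in> A"
      using Q(2) xy z ne unfolding clique_def by blast+
    moreover from this have "{y, x} \<in> A" "{x, z} \<in> A" "{y, z} \<in> A" "{x, v} \<in> A" "{y, v} \<in> A"
      using xy(4,5) by (simp_all add: insert_commute)
    ultimately have "\<forall>a\<in>{v, z, x, y}. \<forall>b\<in>{v, z, x, y}. a \<noteq> b \<longrightarrow> {a, b} \<in> A \<or> {a, b} = {v, z}"
      using xy(4,5) by (simp add: doubleton_eq_iff)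
    moreover have "{v, z, x, y} \<subseteq> {..<n}" "card {v, z, x, y} = 4" by fact+
    ultimately show ?thesis using z unfolding perc_step_iff
      by (intro disjI2 conjI exI[of _ "{v, z, x, y}"]) auto
  qed
  then show ?thesis using Q sub by (simp add: clique_insert clique_mono)
qed

lemma card_4_obtain:
  assumes "card S = 4" "x \<in> S" "y \<in> S" "x \<noteq> y"
  obtains z w where "S = {x, y, z, w}" "z \<noteq> x" "z \<noteq> y" "w \<noteq> x" "w \<noteq> y" "z \<noteq> w"
proof -
  have "finite S" using assms(1) card.infinite by fastforce
  then have "card (S - {x, y}) = 2" using assms by (simp add: card_Diff_subset)
  then obtain z w where "S - {x, y} = {z, w}" "z \<noteq> w" by (auto simp: card_2_iff)
  then show thesis using that[of z w] assms by blast
qed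

text \<open>The two endpoints of a late edge need not lie in the large clique, but they are always
  \<^emph>\<open>attached\<close> to it, so that they join it in the next step; this is the invariant that survives
  the induction.\<close>

lemma late_edge_large_clique:
  assumes G: "G \<subseteq> Kn_edges n"
    and "{a, b} \<in> perc_at 4 n G (Suc t)" "{a, b} \<notin> perc_at 4 n G t"
  shows "\<exists>Q \<subseteq> {..<n}. t + 4 \<le> card Q \<and> clique (perc_at 4 n G (Suc t)) Q \<and>
    attached (perc_at 4 n G (Suc t)) Q a \<and> attached (perc_at 4 n G (Suc t)) Q b"
  using assms(2,3)
proof (induction t arbitrary: a b)
  case 0
  then obtain S where S: "S \<subseteq> {..<n}" "card S = 4" "a \<in> S" "b \<in> S"
    "\<forall>u\<in>S. \<forall>v\<in>S. u \<noteq> v \<longrightarrow> {u, v} \<in> G \<or> {u, v} = {a, b}"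
    by (auto simp: perc_at_Suc perc_step_iff)
  have "clique (perc_at 4 n G (Suc 0)) S"
    unfolding clique_def
  proof (intro ballI impI)
    fix u v assume "u \<in> S" "v \<in> S" "u \<noteq> v"
    then have "{u, v} \<in> G \<or> {u, v} = {a, b}" using S(5) by blast
    then show "{u, v} \<in> perc_at 4 n G (Suc 0)"
      using 0(1) perc_at_mono[of 0 "Suc 0" 4 n G] by auto
  qed
  then show ?case using S unfolding attached_def by (intro exI[of _ S]) auto
next
  case (Suc t)
  define A where "A = perc_at 4 n G t"
  define B where "B = perc_at 4 n G (Suc t)"
  define C where "C = perc_at 4 n G (Suc (Suc t))"
  have Bn: "B \<subseteq> Kn_edges n" unfolding B_def by (rule perc_at_subset[OF G])
  have BC: "C = perc_step 4 n B" "B \<subseteq> C"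
    by (auto simp: B_def C_def perc_at_Suc perc_step_def)
  have ab: "{a, b} \<in> C" "{a, b} \<notin> B" using Suc.prems by (simp_all add: B_def C_def)
  then obtain S where S: "S \<subseteq> {..<n}" "card S = 4" "a \<in> S" "b \<in> S"
    "\<forall>u\<in>S. \<forall>v\<in>S. u \<noteq> v \<longrightarrow> {u, v} \<in> B \<or> {u, v} = {a, b}"
    unfolding BC(1) perc_step_iff by blast
  have "{a, b} \<in> Kn_edges n"
    using ab(1) unfolding C_def by (rule subsetD[OF perc_at_subset[OF G]])
  then have "a \<noteq> b" by simp
  have SC: "{u, v} \<in> C" if "u \<in> S" "v \<in> S" "u \<noteq> v" for u v
    using S(5)[rule_format, OF that] ab(1) BC(2) by auto
  \<comment> \<open>Were all other pairs of \<open>S\<close> active one step earlier,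
    \<open>{a, b}\<close> would have come one step earlier too. So \<open>S\<close> has an edge
    \<open>{x, y}\<close> that is new in \<open>B\<close>, and the induction hypothesis applies to
    it.\<close>
  have "\<exists>x\<in>S. \<exists>y\<in>S. x \<noteq> y \<and> {x, y} \<in> B \<and> {x, y} \<notin> A"
  proof (rule ccontr)
    assume *: "\<not> ?thesis"
    have "\<forall>u\<in>S. \<forall>v\<in>S. u \<noteq> v \<longrightarrow> {u, v} \<in> A \<or> {u, v} = {a, b}"
      using * S(5) by metis
    then have "{a, b} \<in> perc_step 4 n A"
      using S(1-4) \<open>a \<noteq> b\<close> unfolding perc_step_iff by (intro disjI2 conjI exI[of _ S])
    then show False using ab(2) by (simp add: A_def B_def perc_at_Suc)
  qed
  then obtain x y where xy: "x \<in> S" "y \<in> S" "x \<noteq> y" "{x, y} \<in> B" "{x, y} \<notin> A" by blast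
  then obtain Q where Q: "Q \<subseteq> {..<n}" "t + 4 \<le> card Q" "clique B Q" "attached B Q x" "attached B Q y"
    using Suc.IH[of x y] unfolding A_def B_def by blast
  have finQ: "finite Q" using Q(1) finite_subset by blast
  \<comment> \<open>All of \<open>S\<close> is a clique in \<open>C\<close>, so \<open>a\<close> and
    \<open>b\<close> are attached to any set containing \<open>x\<close> and \<open>y\<close>. It
    remains to find such a clique with one vertex more than \<open>Q\<close>.\<close>
  have att: "attached C Q' v" if "v \<in> S" "x \<in> Q'" "y \<in> Q'" for v Q'
  proof (cases "v \<in> Q'")
    case False
    then have "{v, x} \<in> C" "{v, y} \<in> C" using that xy(1,2) by (auto intro!: SC)
    then show ?thesis using that xy(3) by (auto simp: attached_def)
  qed (simp add: attached_def)
  have "\<exists>Q' \<subseteq> {..<n}. Suc (card Q) \<le> card Q' \<and> clique C Q' \<and> x \<in> Q' \<and> y \<in> Q'"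
  proof (cases "x \<in> Q \<and> y \<in> Q")
    case False
    let ?Q = "insert x (insert y Q)"
    have "clique C (insert x Q)" "clique C (insert y Q)"
      unfolding BC(1) using Q by (auto intro!: clique_perc_step_insert Bn)
    then have "clique C ?Q" using xy BC(2) by (auto simp: clique_insert)
    moreover have "card (insert x Q) \<le> card ?Q" "card (insert y Q) \<le> card ?Q"
      using finQ by (auto intro!: card_mono)
    then have "Suc (card Q) \<le> card ?Q"
      using False finQ by (auto simp: card_insert_if split: if_splits)
    moreover have "?Q \<subseteq> {..<n}" using Q(1) S(1) xy by auto
    ultimately show ?thesis by blast
  next
    case True
    obtain z w where zw: "S = {x, y, z, w}" "z \<noteq> x" "z \<noteq> y" "w \<noteq> x" "w \<noteq> y" "z \<noteq> w"
      using card_4_obtain[OF S(2) xy(1-3)] .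
    \<comment> \<open>With \<open>x\<close> and \<open>y\<close> already in \<open>Q\<close>, the
      extra vertex must be \<open>z\<close> or \<open>w\<close>. One of them is outside
      \<open>Q\<close>, since otherwise \<open>{a, b}\<close> would lie in \<open>B\<close>.\<close>
    have "\<not> S \<subseteq> Q"
    proof
      assume "S \<subseteq> Q"
      then have "a \<in> Q" "b \<in> Q" using S(3,4) by auto
      then show False using Q(3) ab(2) \<open>a \<noteq> b\<close> by (auto simp: clique_def)
    qed
    have B_edge: "{u, v} \<in> B" if "u \<in> S" "v \<in> S" "u \<noteq> v" "{u, v} \<noteq> {a, b}" for u v
      using S(5)[rule_format, OF that(1-3)] that(4) by simp
    have "\<exists>v\<in>S - Q. attached B Q v"
    proof (cases "{a, b} = {z, w}")
      case True
      then have "{v, x} \<in> B \<and> {v, y} \<in> B" if "v \<in> {z, w}" for v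
        using zw that by (auto intro!: B_edge simp: doubleton_eq_iff)
      moreover obtain v where "v \<in> S - Q" "v \<in> {z, w}"
        using \<open>\<not> S \<subseteq> Q\<close> \<open>x \<in> Q \<and> y \<in> Q\<close> zw(1) by blast
      ultimately show ?thesis using \<open>x \<in> Q \<and> y \<in> Q\<close> xy(3) unfolding attached_def by blast
    next
      case F: False
      \<comment> \<open>Exactly one end \<open>p\<close> of the missing edge is among
        \<open>z, w\<close>; the other end is \<open>x\<close> or \<open>y\<close>. Then
        \<open>q\<close> sees both \<open>x\<close> and \<open>y\<close>; and if \<open>q\<close> is
        in \<open>Q\<close> already, \<open>p\<close> sees \<open>q\<close> and the one of
        \<open>x, y\<close> that is not its missing partner.\<close>
      have *: "\<exists>v\<in>S - Q. attached B Q v"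
        if p: "S = {x, y, p, q}" "p \<noteq> x" "p \<noteq> y" "q \<noteq> x" "q \<noteq> y" "p \<noteq> q"
          and pab: "p \<in> {a, b}" and q: "q \<notin> {a, b}" for p q
      proof (cases "q \<in> Q")
        case False
        have "{q, x} \<in> B" "{q, y} \<in> B" using p q by (auto intro!: B_edge simp: doubleton_eq_iff)
        then show ?thesis using False p(1) \<open>x \<in> Q \<and> y \<in> Q\<close> xy(3) unfolding attached_def by blast
      next
        case qQ: True
        then have "p \<notin> Q" using \<open>\<not> S \<subseteq> Q\<close> \<open>x \<in> Q \<and> y \<in> Q\<close> p(1) by blast
        obtain c where c: "c \<in> {x, y}" "{p, c} \<noteq> {a, b}"
          using xy(3) by (metis doubleton_eq_iff insertCI)
        have "p \<in> S" "q \<in> S" "c \<in> S" "p \<noteq> c" "c \<noteq> q" using p c(1) by auto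
        moreover have "{p, q} \<noteq> {a, b}" using q by auto
        ultimately have "{p, c} \<in> B" "{p, q} \<in> B" using p(6) c(2) by (simp_all add: B_edge)
        moreover have "c \<in> Q" using c(1) \<open>x \<in> Q \<and> y \<in> Q\<close> by blast
        ultimately have "attached B Q p" using qQ \<open>c \<noteq> q\<close> unfolding attached_def by metis
        then show ?thesis using \<open>p \<in> S\<close> \<open>p \<notin> Q\<close> by blast
      qed
      have "{a, b} \<noteq> {x, y}" using ab xy by auto
      moreover have "{a, b} = {x, y}" if "z \<notin> {a, b}" "w \<notin> {a, b}"
      proof -
        have "a \<in> {x, y}" "b \<in> {x, y}" using that S(3,4) zw(1) by auto
        then show ?thesis using \<open>a \<noteq> b\<close> by auto
      qed
      moreover have "{a, b} = {z, w}" if "z \<in> {a, b}" "w \<in> {a, b}"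
        using that zw(6) by auto
      ultimately consider "z \<in> {a, b}" "w \<notin> {a, b}" | "w \<in> {a, b}" "z \<notin> {a, b}"
        using F by blast
      then show ?thesis
      proof cases
        case 1
        then show ?thesis by (rule *[OF zw])
      next
        case 2
        have "S = {x, y, w, z}" using zw(1) by blast
        then show ?thesis using 2 zw(2-6) by (intro *[of w z]) auto
      qed
    qed
    then obtain v where v: "v \<in> S" "v \<notin> Q" "attached B Q v" by blast
    have "clique C (insert v Q)" unfolding BC(1)
      using clique_perc_step_insert[OF Bn Q(1,3) v(3)] .
    moreover have "card (insert v Q) = Suc (card Q)" using v finQ by simp
    ultimately show ?thesis using v S(1) Q(1) True by (intro exI[of _ "insert v Q"]) auto
  qed
  then obtain Q' where Q': "Q' \<subseteq> {..<n}" "Suc (card Q) \<le> card Q'" "clique C Q'" "x \<in> Q'" "y \<in> Q'"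
    by blast
  have "Suc t + 4 \<le> card Q'" using Q(2) Q'(2) by simp
  then show ?case using att[OF S(3)] att[OF S(4)] Q' unfolding C_def[symmetric] by blast
qed

lemma sat_time_4_le:
  assumes "3 \<le> n" "G \<subseteq> Kn_edges n"
  shows "sat_time 4 n G \<le> n - 3"
proof (cases "sat_time 4 n G")
  case (Suc t)
  obtain f where f: "f \<in> perc_at 4 n G (Suc t)" "f \<notin> perc_at 4 n G t"
    using sat_time_last[OF Suc] by blast
  have "f \<in> Kn_edges n" using f(1) perc_at_subset[OF assms(2)] by blast
  then obtain a b where "f = {a, b}" by (rule in_Kn_edgesE)
  then obtain Q where "Q \<subseteq> {..<n}" "t + 4 \<le> card Q"
    using late_edge_large_clique[OF assms(2)] f by blast
  then show ?thesis using card_mono[of "{..<n}" Q] Suc by simp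
qed simp

text \<open>Vertex \<open>m\<close> sends two edges down, to \<open>m - 1\<close> and \<open>m - 3\<close>; these two are not joined
  initially, so \<open>m\<close> has to wait until the clique has reached \<open>m - 1\<close>.\<close>

definition ladder :: "nat \<Rightarrow> nat set set" where
  "ladder n = {{u, v} | u v. v < n \<and> (v = u + 1 \<or> v = u + 3 \<or> (u = 0 \<and> v = 2))}"

lemma doubleton_in_ladder:
  assumes "u < v"
  shows "{u, v} \<in> ladder n \<longleftrightarrow> v < n \<and> (v = u + 1 \<or> v = u + 3 \<or> (u = 0 \<and> v = 2))"
  using assms unfolding ladder_def by (auto simp: doubleton_eq_iff)

text \<open>The edge \<open>{0, 2}\<close> completes the triangle on \<open>0, 1, 2\<close>, the
  clique present at time \<open>0\<close>. Afterwards \<open>t + 3\<close> is the only new vertex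
  with both lower neighbours, \<open>t + 2\<close> and \<open>t\<close>, in the current
  clique.\<close>

lemma perc_at_ladder:
  assumes "u < v"
  shows "{u, v} \<in> perc_at 4 n (ladder n) t \<longleftrightarrow> v < n \<and> (v < t + 3 \<or> {u, v} \<in> ladder n)"
  using assms
proof (induction t arbitrary: u v)
  case 0
  then have "v < 3 \<Longrightarrow> u = 0 \<and> v = 2 \<or> v = u + 1" by auto
  then show ?case using 0 by (auto simp: doubleton_in_ladder)
next
  case (Suc t)
  define A where "A = perc_at 4 n (ladder n) t"
  have IH: "{u, v} \<in> A \<longleftrightarrow> v < n \<and> (v < t + 3 \<or> v = u + 1 \<or> v = u + 3 \<or> (u = 0 \<and> v = 2))"
    if "u < v" for u v
    using Suc.IH[OF that] that by (auto simp: A_def doubleton_in_ladder)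
  have "{u, v} \<in> perc_step 4 n A \<longleftrightarrow> v < n \<and> (v < t + 4 \<or> {u, v} \<in> ladder n)"
  proof
    assume *: "{u, v} \<in> perc_step 4 n A"
    show "v < n \<and> (v < t + 4 \<or> {u, v} \<in> ladder n)"
    proof (cases "{u, v} \<in> A")
      case True
      then show ?thesis using IH Suc.prems by (auto simp: doubleton_in_ladder)
    next
      case False
      then obtain S where S: "S \<subseteq> {..<n}" "card S = 4" "u \<in> S" "v \<in> S"
        and e: "\<forall>x\<in>S. \<forall>y\<in>S. x \<noteq> y \<longrightarrow> {x, y} \<in> A \<or> {x, y} = {u, v}"
        using * unfolding perc_step_iff by blast
      have fin: "finite S" using S(1) finite_subset by blast
      \<comment> \<open>If \<open>m\<close> were at least \<open>t + 4\<close>, its only smaller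
        neighbours in \<open>A\<close> would be \<open>m - 1\<close> and \<open>m - 3\<close>. With
        four vertices in \<open>S\<close>, \<open>m\<close> must then be an end of the missing edge
        and both neighbours lie in \<open>S\<close>; but they differ by two and are not adjacent in
        \<open>A\<close>.\<close>
      define m where "m = Max S"
      have m: "m \<in> S" "\<And>x. x \<in> S \<Longrightarrow> x \<le> m"
        unfolding m_def using Max_in[OF fin] Max_ge[OF fin] S(3) by auto
      have "m < t + 4"
      proof (rule ccontr)
        assume m4: "\<not> m < t + 4"
        have nb: "x = m - 1 \<or> x = m - 3" if "x \<in> S" "x \<noteq> m" "{x, m} \<noteq> {u, v}" for x
        proof -
          have "x < m" using m(2)[OF that(1)] that(2) by simp
          moreover have "{x, m} \<in> A" using e that m(1) by blast
          ultimately show ?thesis using IH[of x m] m4 by auto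
        qed
        show False
        proof (cases "m \<in> {u, v}")
          case False
          then have "S \<subseteq> {m, m - 1, m - 3}" using nb by blast
          then have "card S \<le> card {m, m - 1, m - 3}" by (intro card_mono) auto
          also have "\<dots> \<le> 3" by (simp add: card_insert_if)
          finally show False using S(2) by simp
        next
          case True
          then have mv: "m = v" using Suc.prems m(2)[OF S(4)] by auto
          have sub: "S \<subseteq> {u, m, m - 1, m - 3}"
            using nb mv by (auto simp: doubleton_eq_iff)
          have "{m - 1, m - 3} \<subseteq> S - {u, v}"
          proof -
            have "card (S - {u, v}) = 2"
              using S fin Suc.prems by (simp add: card_Diff_subset)
            moreover have "S - {u, v} \<subseteq> {m - 1, m - 3}" using sub mv by blast
            moreover have "card {m - 1, m - 3} = 2" using m4 by auto
            ultimately have "S - {u, v} = {m - 1, m - 3}" by (intro card_subset_eq) auto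
            then show ?thesis by simp
          qed
          then have "{m - 3, m - 1} \<in> A \<or> {m - 3, m - 1} = {u, v}" "m - 3 \<notin> {u, v}"
            using e m4 by auto
          then have "{m - 3, m - 1} \<in> A" by auto
          moreover have "m - 3 < m - 1" using m4 by simp
          ultimately show False using IH[of "m - 3" "m - 1"] m4 by auto
        qed
      qed
      then have "v < t + 4" using m(2)[OF S(4)] by simp
      then show ?thesis using S by auto
    qed
  next
    assume *: "v < n \<and> (v < t + 4 \<or> {u, v} \<in> ladder n)"
    show "{u, v} \<in> perc_step 4 n A"
    proof (cases "{u, v} \<in> A")
      case True
      then show ?thesis by (auto simp: perc_step_def)
    next
      case False
      then have v: "v = t + 3" "v < n" "u \<noteq> t + 2" "u \<noteq> t"
        using * IH[OF Suc.prems] by (auto simp: doubleton_in_ladder[OF Suc.prems])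
      \<comment> \<open>Here \<open>v = t + 3\<close>, and the last two vertices are its initial
        lower neighbours.\<close>
      let ?S = "{u, v, t + 2, t}"
      have "card ?S = 4" using v Suc.prems by auto
      moreover have "?S \<subseteq> {..<n}" using v Suc.prems by auto
      moreover have *: "{x, y} \<in> A \<or> {x, y} = {u, v}"
        if xy: "x \<in> ?S" "y \<in> ?S" "x < y" for x y
      proof (cases "y < t + 3")
        case True
        then show ?thesis using IH[OF xy(3)] v by simp
      next
        case False
        then have "y = v" "x = u \<or> x = t + 2 \<or> x = t" using xy v Suc.prems by auto
        then show ?thesis using IH[OF xy(3)] v by auto
      qed
      have "\<forall>x\<in>?S. \<forall>y\<in>?S. x \<noteq> y \<longrightarrow> {x, y} \<in> A \<or> {x, y} = {u, v}"
      proof (intro ballI impI)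
        fix x y assume xy: "x \<in> ?S" "y \<in> ?S" "x \<noteq> y"
        then consider "x < y" | "y < x" by linarith
        then show "{x, y} \<in> A \<or> {x, y} = {u, v}"
          using *[OF xy(1,2)] *[OF xy(2,1)] by cases (simp_all add: insert_commute)
      qed
      ultimately show ?thesis using Suc.prems unfolding perc_step_iff
        by (intro disjI2 conjI exI[of _ ?S]) auto
    qed
  qed
  then have "{u, v} \<in> perc_at 4 n (ladder n) (Suc t) \<longleftrightarrow> v < n \<and> (v < t + 4 \<or> {u, v} \<in> ladder n)"
    unfolding perc_at_Suc A_def .
  moreover have "Suc t + 3 = t + 4" by simp
  ultimately show ?case by presburger
qed

lemma tau_max_4_eq:
  assumes "3 \<le> n"
  shows "tau_max n 4 = n - 3"
proof (rule antisym)
  show "tau_max n 4 \<le> n - 3" using sat_time_4_le[OF assms] by (intro tau_max_le)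
  show "n - 3 \<le> tau_max n 4"
  proof (cases "n = 3")
    case False
    then have n: "4 \<le> n" using assms by simp
    have G: "ladder n \<subseteq> Kn_edges n" by (auto simp: ladder_def)
    \<comment> \<open>The ends differ by two and \<open>n \<ge> 4\<close> excludes
      \<open>{0, 2}\<close>, so this edge at the top vertex is not an initial one.\<close>
    have edge: "{n - 3, n - 1} \<in> perc_at 4 n (ladder n) t \<longleftrightarrow> n - 3 \<le> t" for t
      using n by (subst perc_at_ladder) (auto simp: doubleton_in_ladder)
    have "n - 3 \<le> sat_time 4 n (ladder n)"
      by (rule sat_time_ge[OF G, where f = "{n - 3, n - 1}" and s = "n - 3"])
        (simp_all only: edge not_le order_refl)
    then show ?thesis by (rule tau_max_ge[OF G])
  qed simp
qed

subsection \<open>Chains of cliques\<close>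

text \<open>Distance at most two in the union of the first \<open>i\<close> cliques:
  \<open>j = k\<close> covers adjacency, a common vertex of two cliques covers paths of length
  two.\<close>

definition linked :: "(nat \<Rightarrow> nat set) \<Rightarrow> nat \<Rightarrow> nat \<Rightarrow> nat \<Rightarrow> bool" where
  "linked H i u v \<longleftrightarrow> (\<exists>j<i. \<exists>k<i. u \<in> H j \<and> v \<in> H k \<and> H j \<inter> H k \<noteq> {})"

lemma linked_sym: "linked H i u v \<Longrightarrow> linked H i v u"
  unfolding linked_def by blast

text \<open>\<open>e i\<close> glues \<open>H i\<close> to the chain so far,
  \<open>e (Suc i)\<close> is where the next clique is glued on, and \<open>e m\<close> is the free
  end. \<open>unlinked\<close> looks only at cliques before \<open>H i\<close>, which is what a
  greedy choice can secure; statements about arbitrary pairs of cliques are derived from it.\<close>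

locale chain =
  fixes r n m :: nat and H e :: "nat \<Rightarrow> nat set"
  assumes H_subset: "i < m \<Longrightarrow> H i \<subseteq> {..<n}"
    and card_H: "i < m \<Longrightarrow> card (H i) = r"
    and e_subset: "i < m \<Longrightarrow> e i \<subseteq> H i"
    and e_Suc_subset: "i < m \<Longrightarrow> e (Suc i) \<subseteq> H i"
    and e_disjoint: "i < m \<Longrightarrow> e i \<inter> e (Suc i) = {}"
    and card_e: "i \<le> m \<Longrightarrow> card (e i) = 2"
    and unlinked: "\<lbrakk>i < m; u \<in> H i; v \<in> H i; u \<noteq> v; {u, v} \<noteq> e i\<rbrakk> \<Longrightarrow> \<not> linked H i u v"
begin

lemma e_obtain:
  assumes "i \<le> m"
  obtains u v where "e i = {u, v}" "u \<noteq> v"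
  using card_e[OF assms] by (auto simp: card_2_iff)

lemma e_neq_Suc: "i < m \<Longrightarrow> e i \<noteq> e (Suc i)"
  using e_disjoint[of i] card_e[of i] by auto

text \<open>A pair inside an earlier clique is linked, so \<open>unlinked\<close> leaves only
  \<open>e i\<close>. If \<open>H j\<close> were not the immediate predecessor \<open>H k\<close>,
  the pair would also be shared by \<open>H j\<close> and \<open>H k\<close> and thus equal
  \<open>e k\<close>, against disjointness.\<close>

lemma shared_pair:
  assumes "j < i" "i < m" "u \<noteq> v" "{u, v} \<subseteq> H i" "{u, v} \<subseteq> H j"
  shows "{u, v} = e i \<and> i = Suc j"
proof -
  have eq: "{u, v} = e k" if "j < k" "k < m" "{u, v} \<subseteq> H k" for k
  proof (rule ccontr)
    assume "{u, v} \<noteq> e k"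
    then have "\<not> linked H k u v" using unlinked[of k u v] that assms(3) by simp
    moreover have "linked H k u v"
      unfolding linked_def using assms(5) that(1) by (intro exI[of _ j]) auto
    ultimately show False by blast
  qed
  have ei: "{u, v} = e i" using eq assms by simp
  moreover have "i = Suc j"
  proof (rule ccontr)
    assume "i \<noteq> Suc j"
    then obtain k where k: "i = Suc k" "j < k" using assms(1) by (cases i) auto
    then have "e i \<subseteq> H k" using e_Suc_subset[of k] assms(2) by simp
    then have "{u, v} \<subseteq> H k" unfolding ei .
    then have "{u, v} = e k" using eq k assms(2) by simp
    then show False using ei e_neq_Suc[of k] k assms(2) by simp
  qed
  ultimately show ?thesis ..
qed

lemma shared_pair_cases:
  assumes "i < m" "j < m" "i \<noteq> j" "u \<noteq> v" "{u, v} \<subseteq> H i" "{u, v} \<subseteq> H j"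
  shows "{u, v} = e i \<or> {u, v} = e (Suc i)"
  using shared_pair[of j i u v] shared_pair[of i j u v] assms by (cases "j < i") auto

lemma e_subset_H:
  assumes "i \<le> m" "j < m" "e i \<subseteq> H j"
  shows "j = i \<or> Suc j = i"
proof -
  obtain u v where uv: "e i = {u, v}" "u \<noteq> v" using e_obtain[OF assms(1)] .
  consider "j = i" | "j < i" "i < m" | "i < j" | "j < i" "i = m" using assms(1) by linarith
  then show ?thesis
  proof cases
    case 2
    then show ?thesis using shared_pair[of j i u v] uv assms e_subset[of i] by simp
  next
    case 3
    then have "{u, v} = e j \<and> j = Suc i"
      using shared_pair[of i j u v] uv assms e_subset[of i] by simp
    then show ?thesis using uv e_neq_Suc[of i] 3 assms by simp
  next
    \<comment> \<open>There is no clique \<open>H m\<close>; the free end \<open>e m\<close> is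
      therefore viewed inside the last clique.\<close>
    case 4
    then obtain k where k: "i = Suc k" by (cases i) auto
    show ?thesis
    proof (rule ccontr)
      assume "\<not> ?thesis"
      then have "j < k" using 4 k by auto
      then have "{u, v} = e k"
        using shared_pair[of j k u v] uv assms e_Suc_subset[of k] k by simp
      then show False using uv e_neq_Suc[of k] k assms by simp
    qed
  qed simp
qed

lemma inj_on_e: "inj_on e {..m}"
proof (rule linorder_inj_onI)
  fix i j assume ij: "i < j" "i \<in> {..m}" "j \<in> {..m}"
  show "e i \<noteq> e j"
  proof
    assume eq: "e i = e j"
    then have "e j \<subseteq> H i" using e_subset[of i] ij by simp
    then have "j = Suc i" using e_subset_H[of j i] ij by simp
    then show False using eq e_neq_Suc[of i] ij by simp
  qed
qed auto

text \<open>The path through \<open>v\<close> links \<open>u\<close> and \<open>w\<close> before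
  \<open>H k\<close> is added, so they can only be the gluing edge \<open>e k\<close>, which also
  lies in the preceding clique.\<close>

lemma closing_pair:
  assumes "i < k" "j < k" "k < m" "u \<noteq> w"
    and "u \<in> H i" "v \<in> H i" "v \<in> H j" "w \<in> H j" "u \<in> H k" "w \<in> H k"
  shows "u \<in> H (k - 1) \<and> w \<in> H (k - 1)"
proof -
  have "linked H k u w"
    unfolding linked_def using assms by (intro exI[of _ i] exI[of _ j] conjI) auto
  then have "{u, w} = e k" using unlinked[of k u w] assms by auto
  moreover obtain l where "k = Suc l" using assms(1) by (cases k) auto
  ultimately show ?thesis using e_Suc_subset[of l] assms(3) by auto
qed

text \<open>Descent on the sum of the indices: a strictly largest index can be lowered by
  \<open>closing_pair\<close>, and once two indices agree that clique contains all three
  vertices.\<close>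

lemma triangle_in_H:
  assumes "i < m" "j < m" "k < m" "u \<noteq> v" "v \<noteq> w" "u \<noteq> w"
    and "u \<in> H i" "v \<in> H i" "v \<in> H j" "w \<in> H j" "u \<in> H k" "w \<in> H k"
  shows "\<exists>l<m. u \<in> H l \<and> v \<in> H l \<and> w \<in> H l"
  using assms
proof (induction "i + j + k" arbitrary: i j k rule: less_induct)
  case less
  consider "i = j \<or> j = k \<or> i = k" | "i < k" "j < k" | "j < i" "k < i" | "i < j" "k < j"
    by linarith
  then show ?case
  proof cases
    case 1
    then show ?thesis using less.prems by auto
  next
    case 2
    then have "u \<in> H (k - 1) \<and> w \<in> H (k - 1)"
      using closing_pair[of i k j u w v] less.prems by simp
    then show ?thesis using less.hyps[of i j "k - 1"] less.prems 2 by simp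
  next
    case 3
    then have "v \<in> H (i - 1) \<and> u \<in> H (i - 1)"
      using closing_pair[of j i k v u w] less.prems by simp
    then show ?thesis using less.hyps[of "i - 1" j k] less.prems 3 by simp
  next
    case 4
    then have "v \<in> H (j - 1) \<and> w \<in> H (j - 1)"
      using closing_pair[of i j k v w u] less.prems by simp
    then show ?thesis using less.hyps[of i "j - 1" k] less.prems 4 by simp
  qed
qed

definition joined :: "nat \<Rightarrow> nat \<Rightarrow> bool" where
  "joined u v \<longleftrightarrow> (\<exists>i<m. u \<in> H i \<and> v \<in> H i)"

lemma joined_sym: "joined u v \<Longrightarrow> joined v u"
  unfolding joined_def by blast

lemma joined_triangle:
  assumes "joined u v" "joined v w" "joined u w" "u \<noteq> v" "v \<noteq> w" "u \<noteq> w"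
  obtains l where "l < m" "u \<in> H l" "v \<in> H l" "w \<in> H l"
  using assms triangle_in_H unfolding joined_def by blast

text \<open>Three vertices \<open>c\<close>, \<open>d\<close>, \<open>f\<close> away from the missing edge span a triangle in some \<open>H l\<close>. Any other
  vertex forms a triangle with each of the three sides, and at most two sides of the triangle lie
  in a further \<open>H l'\<close>.\<close>

lemma near_clique:
  assumes "5 \<le> r" "card S = r" "\<And>u v. \<lbrakk>u \<in> S; v \<in> S; u \<noteq> v; {u, v} \<noteq> {a, b}\<rbrakk> \<Longrightarrow> joined u v"
  shows "\<exists>l<m. S = H l"
proof -
  have fin: "finite S" using assms(1,2) card.infinite by fastforce
  \<comment> \<open>This is where \<open>5 \<le> r\<close> enters: removing two vertices must leave
    a triangle.\<close>
  have "card S \<le> card (S - {a, b}) + card {a, b}"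
    by (rule order.trans[OF card_mono card_Un_le]) (use fin in auto)
  moreover have "card {a, b} \<le> 2" by (simp add: card_insert_if)
  ultimately have "3 \<le> card (S - {a, b})" using assms(1,2) by linarith
  then obtain T where "T \<subseteq> S - {a, b}" "card T = 3" using obtain_subset_with_card_n by metis
  then obtain c d f where cdf: "{c, d, f} \<subseteq> S - {a, b}" "c \<noteq> d" "d \<noteq> f" "c \<noteq> f"
    by (auto simp: card_3_iff)
  have J: "joined x y" if "x \<in> S" "y \<in> {c, d, f}" "x \<noteq> y" for x y
  proof -
    have "y \<in> S" "{x, y} \<noteq> {a, b}" using that cdf(1) by (auto simp: doubleton_eq_iff)
    then show ?thesis using assms(3) that by blast
  qed
  obtain l where l: "l < m" "c \<in> H l" "d \<in> H l" "f \<in> H l"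
    using joined_triangle[of c d f] J cdf by auto
  have "x \<in> H l" if x: "x \<in> S" for x
  proof (rule ccontr)
    assume "x \<notin> H l"
    then have ne: "x \<noteq> c" "x \<noteq> d" "x \<noteq> f" using l by auto
    have shared: "{p, q} = e l \<or> {p, q} = e (Suc l)"
      if pq: "p \<in> {c, d, f}" "q \<in> {c, d, f}" "p \<noteq> q" for p q
    proof -
      have "p \<in> S" "x \<noteq> p" "x \<noteq> q" "p \<in> H l" "q \<in> H l" using pq(1,2) cdf(1) ne l by auto
      moreover from this obtain k where "k < m" "x \<in> H k" "p \<in> H k" "q \<in> H k"
        using joined_triangle[of x p q] J x pq by metis
      ultimately show ?thesis
        using shared_pair_cases[of l k p q] \<open>x \<notin> H l\<close> l(1) pq(3) by auto
    qed
    have "{c, d} \<noteq> {c, f}" "{c, d} \<noteq> {d, f}" "{c, f} \<noteq> {d, f}"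
      using cdf(2-4) by (simp_all add: doubleton_eq_iff)
    then show False using shared[of c d] shared[of c f] shared[of d f] cdf(2-4) by simp metis
  qed
  then have "S \<subseteq> H l" by blast
  moreover have "finite (H l)" using card_H[OF l(1)] assms(1) card.infinite by fastforce
  ultimately have "S = H l" using card_subset_eq card_H[OF l(1)] assms(2) by metis
  then show ?thesis using l(1) by blast
qed

section \<open>The percolation process on a chain\<close>

definition joined_edges :: "nat set set" where
  "joined_edges = {{u, v} | u v. u \<noteq> v \<and> joined u v}"

text \<open>The edge \<open>e 0\<close> is kept, so that \<open>H 0\<close> lacks only
  \<open>e 1\<close> and the process can begin.\<close>

definition start :: "nat set set" where
  "start = joined_edges - e ` {1..m}"

lemma doubleton_in_joined_edges: "{u, v} \<in> joined_edges \<longleftrightarrow> u \<noteq> v \<and> joined u v"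
  unfolding joined_edges_def using joined_sym by (auto simp: doubleton_eq_iff)

lemma joined_edges_subset: "joined_edges \<subseteq> Kn_edges n"
proof -
  have "u < n \<and> v < n" if "joined u v" for u v
    using that H_subset unfolding joined_def by blast
  then show ?thesis unfolding joined_edges_def Kn_edges_def by blast
qed

lemma start_subset: "start \<subseteq> Kn_edges n"
  using joined_edges_subset by (auto simp: start_def)

lemma e_in_joined_edges:
  assumes "1 \<le> i" "i \<le> m"
  shows "e i \<in> joined_edges"
proof -
  obtain u v where uv: "e i = {u, v}" "u \<noteq> v" using e_obtain[OF assms(2)] .
  obtain k where "i = Suc k" using assms(1) by (cases i) auto
  then have "joined u v" using e_Suc_subset[of k] uv assms(2) unfolding joined_def
    by (intro exI[of _ k]) auto
  then show ?thesis using uv by (simp add: doubleton_in_joined_edges)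
qed

lemma e_in_stage:
  assumes "1 \<le> i" "i \<le> m" "t \<le> m" "e i \<in> start \<union> e ` {1..t}"
  shows "i \<le> t"
proof -
  have "e i \<notin> start" using assms(1,2) by (auto simp: start_def)
  then obtain s where "s \<in> {1..t}" "e i = e s" using assms(4) by auto
  then show ?thesis using inj_onD[OF inj_on_e, of i s] assms by auto
qed

text \<open>By \<open>near_clique\<close> only the \<open>H l\<close> can complete an edge, and the
  only \<open>e i\<close> inside \<open>H l\<close> are \<open>e l\<close> and
  \<open>e (Suc l)\<close>. Hence activity passes from one gluing edge to the next, one per
  step.\<close>

lemma stage_step:
  assumes "5 \<le> r" "t < m"
  shows "{a, b} \<in> perc_step r n (start \<union> e ` {1..t}) \<longleftrightarrow> {a, b} \<in> start \<union> e ` {1..Suc t}"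
proof
  let ?G = "start \<union> e ` {1..t}"
  have F: "{u, v} \<in> joined_edges" if "{u, v} \<in> ?G" for u v
    using that e_in_joined_edges assms(2) by (auto simp: start_def)
  assume *: "{a, b} \<in> perc_step r n ?G"
  show "{a, b} \<in> start \<union> e ` {1..Suc t}"
  proof (cases "{a, b} \<in> ?G")
    case True
    then show ?thesis by auto
  next
    case new: False
    then obtain S where S: "a \<noteq> b" "card S = r" "a \<in> S" "b \<in> S"
      and G: "\<forall>u\<in>S. \<forall>v\<in>S. u \<noteq> v \<longrightarrow> {u, v} \<in> ?G \<or> {u, v} = {a, b}"
      using * unfolding perc_step_iff by blast
    have "joined u v" if "u \<in> S" "v \<in> S" "u \<noteq> v" "{u, v} \<noteq> {a, b}" for u v
      using G[rule_format, OF that(1-3)] that(4) F doubleton_in_joined_edges by metis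
    then obtain l where l: "l < m" "S = H l" using near_clique[OF assms(1) S(2)] by blast
    have inG: "i \<le> t" if i: "1 \<le> i" "i \<le> m" "e i \<subseteq> H l" "e i \<noteq> {a, b}" for i
    proof -
      obtain u v where uv: "e i = {u, v}" "u \<noteq> v" using e_obtain[OF i(2)] .
      have "u \<in> S" "v \<in> S" using i(3) uv(1) l(2) by auto
      then have "e i \<in> ?G" using G[rule_format, of u v] i(4) uv by simp
      then show ?thesis using e_in_stage[of i t] i assms(2) by simp
    qed
    have "joined a b" using S l unfolding joined_def by blast
    then have "{a, b} \<in> joined_edges" using S(1) by (simp add: doubleton_in_joined_edges)
    then obtain k where k: "1 \<le> k" "k \<le> m" "{a, b} = e k" using new by (auto simp: start_def)
    have "t < k" using new k by (auto simp: not_le[symmetric])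
    have "e k \<subseteq> H l" using S l k(3) by (metis empty_subsetI insert_subset)
    \<comment> \<open>A clique might complete its earlier edge \<open>e l\<close> from
      \<open>e (Suc l)\<close> instead, but this requires \<open>e (Suc l)\<close> to be active
      already, out of order.\<close>
    then consider "l = k" | "Suc l = k" using e_subset_H[OF k(2) l(1)] by blast
    then have "k \<le> Suc t"
    proof cases
      case 1
      then have "Suc l \<le> t"
        using inG[of "Suc l"] e_Suc_subset[OF l(1)] e_neq_Suc[OF l(1)] l(1) k(3) by simp
      then show ?thesis using \<open>l = k\<close> by simp
    next
      case 2
      then have "1 \<le> l \<Longrightarrow> l \<le> t"
        using inG[of l] e_subset[OF l(1)] e_neq_Suc[OF l(1)] l(1) k(3) by simp
      then show ?thesis using \<open>Suc l = k\<close> by (cases l) auto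
    qed
    then show ?thesis using k by auto
  qed
next
  let ?G = "start \<union> e ` {1..t}"
  assume "{a, b} \<in> start \<union> e ` {1..Suc t}"
  then consider "{a, b} \<in> ?G" | "{a, b} = e (Suc t)" by (auto simp: le_Suc_eq)
  then show "{a, b} \<in> perc_step r n ?G"
  proof cases
    case 1
    then show ?thesis by (simp add: perc_step_def)
  next
    case 2
    have sub: "{a, b} \<subseteq> H t" using e_Suc_subset[OF assms(2)] 2 by simp
    have "card {a, b} = 2" using card_e[of "Suc t"] assms(2) 2 by simp
    then have "a \<noteq> b" by auto
    have "{u, v} \<in> ?G \<or> {u, v} = {a, b}" if uv: "u \<in> H t" "v \<in> H t" "u \<noteq> v" for u v
    proof (cases "{u, v} \<in> start")
      case False
      have "joined u v" using uv assms(2) unfolding joined_def by blast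
      then have "{u, v} \<in> joined_edges" using uv by (simp add: doubleton_in_joined_edges)
      then obtain s where s: "1 \<le> s" "s \<le> m" "{u, v} = e s" using False by (auto simp: start_def)
      moreover have "e s \<subseteq> H t" using uv s(3) by (metis empty_subsetI insert_subset)
      ultimately have "t = s \<or> Suc t = s" using e_subset_H assms(2) by simp
      then show ?thesis using s 2 by auto
    qed simp
    then show ?thesis using \<open>a \<noteq> b\<close> sub H_subset[OF assms(2)] card_H[OF assms(2)]
      unfolding perc_step_iff by (intro disjI2 conjI exI[of _ "H t"]) auto
  qed
qed

lemma perc_at_start:
  assumes "5 \<le> r" "t \<le> m"
  shows "perc_at r n start t = start \<union> e ` {1..t}"
  using assms(2)
proof (induction t)
  case (Suc t)
  have stage: "start \<union> e ` {1..s} \<subseteq> Kn_edges n" if "s \<le> m" for s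
    using that start_subset e_in_joined_edges joined_edges_subset by fastforce
  have "perc_step r n (start \<union> e ` {1..t}) = start \<union> e ` {1..Suc t}"
    using stage[of t] stage[of "Suc t"] Suc.prems stage_step[OF assms(1)]
    by (intro edge_set_eqI[of _ n] perc_step_subset) simp_all
  then show ?case using Suc by (simp add: perc_at_Suc)
qed simp

lemma le_tau_max:
  assumes "5 \<le> r"
  shows "m \<le> tau_max n r"
proof (cases "m = 0")
  case False
  have "e m \<in> perc_at r n start m" using False perc_at_start[OF assms, of m] by simp
  moreover have "e m \<notin> perc_at r n start t" if "t < m" for t
    using e_in_stage[of m t] that perc_at_start[OF assms, of t] by auto
  ultimately have "m \<le> sat_time r n start" by (rule sat_time_ge[OF start_subset])
  then show ?thesis by (rule tau_max_ge[OF start_subset])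
qed simp

end

subsection \<open>Greedy construction of long chains\<close>

text \<open>Degree in the hypergraph of cliques; the number of neighbours in the graph is larger by
  a factor of at most \<open>r - 1\<close> for cliques of size \<open>r\<close>.\<close>

definition degree :: "(nat \<Rightarrow> nat set) \<Rightarrow> nat \<Rightarrow> nat \<Rightarrow> nat" where
  "degree H m v = card {j. j < m \<and> v \<in> H j}"

lemma card_UN_bound:
  assumes "finite I" "\<And>i. i \<in> I \<Longrightarrow> card (A i) \<le> c"
  shows "card (\<Union>i\<in>I. A i) \<le> card I * c"
proof -
  have "card (\<Union>i\<in>I. A i) \<le> (\<Sum>i\<in>I. card (A i))" by (rule card_UN_le[OF assms(1)])
  also have "\<dots> \<le> card I * c" using sum_bounded_above[of I "\<lambda>i. card (A i)" c] assms(2) by simp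
  finally show ?thesis .
qed

lemma sum_degree:
  assumes "\<And>j. j < m \<Longrightarrow> H j \<subseteq> {..<n}" "\<And>j. j < m \<Longrightarrow> card (H j) = r"
  shows "(\<Sum>v<n. degree H m v) = m * r"
proof -
  have "(\<Sum>v<n. degree H m v) = (\<Sum>v<n. \<Sum>j<m. if v \<in> H j then 1 else 0)"
  proof (rule sum.cong[OF refl])
    fix v
    have "{j. j < m \<and> v \<in> H j} = {j \<in> {..<m}. v \<in> H j}" by auto
    then show "degree H m v = (\<Sum>j<m. if v \<in> H j then 1 else 0)"
      by (simp add: degree_def sum.If_cases Int_def)
  qed
  also have "\<dots> = (\<Sum>j<m. \<Sum>v<n. if v \<in> H j then 1 else 0)" by (rule sum.swap)
  also have "\<dots> = (\<Sum>j<m. r)"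
  proof (rule sum.cong[OF refl])
    fix j assume "j \<in> {..<m}"
    then have "{..<n} \<inter> H j = H j" "card (H j) = r" using assms by auto
    then show "(\<Sum>v<n. if v \<in> H j then 1 else 0) = r" by (simp add: sum.If_cases)
  qed
  finally show ?thesis by simp
qed

text \<open>Markov's inequality for the degrees, whose total is known from
  \<open>sum_degree\<close>.\<close>

lemma card_high_degree:
  assumes "\<And>j. j < m \<Longrightarrow> H j \<subseteq> {..<n}" "\<And>j. j < m \<Longrightarrow> card (H j) = r"
    and "0 < D" "m * r \<le> D * N"
  shows "card {v. v < n \<and> D \<le> degree H m v} \<le> N"
proof -
  let ?V = "{v. v < n \<and> D \<le> degree H m v}"
  have "D * card ?V = (\<Sum>v\<in>?V. D)" by simp
  also have "\<dots> \<le> (\<Sum>v\<in>?V. degree H m v)" by (rule sum_mono) simp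
  also have "\<dots> \<le> (\<Sum>v<n. degree H m v)" by (rule sum_mono2) auto
  also have "\<dots> \<le> D * N" using sum_degree[OF assms(1,2)] assms(4) by simp
  finally show ?thesis using assms(3) by simp
qed

text \<open>The factors count, in order, a clique through \<open>u\<close>, a vertex
  \<open>x\<close> in it, a clique through \<open>x\<close>, and a vertex of that clique.\<close>

lemma card_linked:
  assumes "\<And>j. j < m \<Longrightarrow> finite (H j)" "\<And>j. j < m \<Longrightarrow> card (H j) \<le> r"
    and "\<And>v. degree H m v \<le> d"
  shows "card {v. linked H m u v} \<le> d * (r * (d * r))"
proof -
  define J where "J v = {j. j < m \<and> v \<in> H j}" for v
  have J: "finite (J v)" "card (J v) \<le> d" for v
    using assms(3)[of v] by (simp_all add: J_def degree_def)
  have "card (\<Union>k\<in>J x. H k) \<le> card (J x) * r" for x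
    using J by (intro card_UN_bound) (auto simp: J_def assms(2))
  then have inner: "card (\<Union>k\<in>J x. H k) \<le> d * r" for x
    using J(2)[of x] by (meson mult_le_mono1 order.trans)
  have "card (\<Union>x\<in>H j. \<Union>k\<in>J x. H k) \<le> card (H j) * (d * r)" if "j < m" for j
    using assms(1)[OF that] inner by (intro card_UN_bound)
  then have middle: "card (\<Union>x\<in>H j. \<Union>k\<in>J x. H k) \<le> r * (d * r)" if "j < m" for j
    using assms(2)[OF that] that by (meson mult_le_mono1 order.trans)
  have "card (\<Union>j\<in>J u. \<Union>x\<in>H j. \<Union>k\<in>J x. H k) \<le> card (J u) * (r * (d * r))"
    using J middle by (intro card_UN_bound) (auto simp: J_def)
  also have "\<dots> \<le> d * (r * (d * r))" using J(2) by (rule mult_le_mono1)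
  also have "(\<Union>j\<in>J u. \<Union>x\<in>H j. \<Union>k\<in>J x. H k) = {v. linked H m u v}"
    unfolding linked_def J_def by blast
  finally show ?thesis .
qed

text \<open>Vertices are added one at a time. The three summands on the left of the bound by
  \<open>n\<close> count what must be avoided: vertices of high degree, vertices already chosen, and
  those within distance two of a chosen one. The pair \<open>e m\<close> is exempt because it is
  already an edge of the chain.\<close>

lemma greedy_vertices:
  assumes "chain r n m H e" "e m \<subseteq> {..<n}" "\<And>v. degree H m v \<le> Suc D"
    and "0 < D" "m * r \<le> D * N" "N + r + r * (Suc D * (r * (Suc D * r))) < n" "k + 2 \<le> r"
  shows "\<exists>Y \<subseteq> {..<n}. card Y = k \<and> e m \<inter> Y = {} \<and> (\<forall>y\<in>Y. degree H m y < D) \<and>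
    (\<forall>u\<in>e m \<union> Y. \<forall>v\<in>e m \<union> Y. u \<noteq> v \<longrightarrow> {u, v} \<noteq> e m \<longrightarrow> \<not> linked H m u v)"
  using assms(7)
proof (induction k)
  case 0
  interpret chain r n m H e by fact
  obtain p q where "e m = {p, q}" "p \<noteq> q" using e_obtain[of m] by blast
  then show ?case by (intro exI[of _ "{}"]) auto
next
  case (Suc k)
  interpret chain r n m H e by fact
  define B where "B = Suc D * (r * (Suc D * r))"
  obtain Y where Y: "Y \<subseteq> {..<n}" "card Y = k" "e m \<inter> Y = {}" "\<forall>y\<in>Y. degree H m y < D"
    and free: "\<forall>u\<in>e m \<union> Y. \<forall>v\<in>e m \<union> Y. u \<noteq> v \<longrightarrow> {u, v} \<noteq> e m \<longrightarrow> \<not> linked H m u v"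
    using Suc by auto
  define X where "X = e m \<union> Y"
  have finY: "finite Y" using Y(1) finite_subset by blast
  have X: "finite X" "X \<subseteq> {..<n}" using assms(2) Y(1) finite_subset unfolding X_def by blast+
  have "card X \<le> card (e m) + card Y" unfolding X_def by (rule card_Un_le)
  then have cardX: "card X \<le> r" using Y(2) card_e[of m] Suc.prems by simp
  have finH: "finite (H j)" if "j < m" for j using H_subset[OF that] finite_subset by blast
  have cardL: "card {v. linked H m u v} \<le> B" for u
    unfolding B_def using finH card_H assms(3) by (intro card_linked) auto
  have L_sub: "{v. linked H m u v} \<subseteq> {..<n}" for u
    unfolding linked_def using H_subset by blast
  define high where "high = {v. v < n \<and> D \<le> degree H m v}"
  have cardhigh: "card high \<le> N"
    unfolding high_def using H_subset card_H assms(4,5) by (intro card_high_degree)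
  define bad where "bad = high \<union> X \<union> (\<Union>u\<in>X. {v. linked H m u v})"
  have "card bad \<le> card high + card X + card (\<Union>u\<in>X. {v. linked H m u v})"
    unfolding bad_def by (meson add_le_mono1 card_Un_le order.trans)
  moreover have "card (\<Union>u\<in>X. {v. linked H m u v}) \<le> card X * B"
    using X(1) cardL by (rule card_UN_bound)
  moreover have "card X * B \<le> r * B" using cardX by (rule mult_le_mono1)
  ultimately have "card bad < card {..<n}"
    using cardX cardhigh assms(6) unfolding B_def[symmetric] card_lessThan by linarith
  moreover have "finite bad"
    by (rule finite_subset[of _ "{..<n}"]) (use X L_sub in \<open>auto simp: bad_def high_def\<close>)
  ultimately have "\<not> {..<n} \<subseteq> bad" using card_mono[of bad "{..<n}"] by linarith
  then obtain y where y: "y < n" "y \<notin> high" "y \<notin> X" "\<And>u. u \<in> X \<Longrightarrow> \<not> linked H m u y"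
    unfolding bad_def by blast
  have y': "\<not> linked H m y u" if "u \<in> X" for u using y(4)[OF that] linked_sym by blast
  have new: "e m \<union> insert y Y = insert y X" by (auto simp: X_def)
  show ?case
  proof (intro exI[of _ "insert y Y"] conjI)
    show "insert y Y \<subseteq> {..<n}" using y(1) Y(1) by simp
    show "card (insert y Y) = Suc k" using y(3) Y(2) finY by (simp add: X_def)
    show "e m \<inter> insert y Y = {}" using Y(3) y(3) by (simp add: X_def)
    show "\<forall>z\<in>insert y Y. degree H m z < D" using Y(4) y(1,2) by (simp add: high_def)
    show "\<forall>u\<in>e m \<union> insert y Y. \<forall>v\<in>e m \<union> insert y Y.
        u \<noteq> v \<longrightarrow> {u, v} \<noteq> e m \<longrightarrow> \<not> linked H m u v"
    proof (unfold new, intro ballI impI)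
      fix u v assume *: "u \<in> insert y X" "v \<in> insert y X" "u \<noteq> v" "{u, v} \<noteq> e m"
      then consider "u \<in> X" "v \<in> X" | "u \<in> X" "v = y" | "u = y" "v \<in> X" by blast
      then show "\<not> linked H m u v"
      proof cases
        case 1
        then show ?thesis using free *(3,4) unfolding X_def by simp
      qed (use y(4) y' in auto)
    qed
  qed
qed

text \<open>Only indices below \<open>i\<close> matter, so appending a clique leaves all earlier
  \<open>unlinked\<close> conditions intact.\<close>

lemma linked_fun_upd:
  assumes "i \<le> m"
  shows "linked (H(m := X)) i = linked H i"
proof -
  have "(H(m := X)) j = H j" if "j < i" for j using that assms by simp
  then show ?thesis unfolding linked_def by (simp del: fun_upd_apply cong: conj_cong)
qed

lemma degree_fun_upd:
  "degree (H(m := X)) (Suc m) v = degree H m v + (if v \<in> X then 1 else 0)"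
proof -
  have "{j. j < Suc m \<and> v \<in> (H(m := X)) j} =
      (if v \<in> X then insert m {j. j < m \<and> v \<in> H j} else {j. j < m \<and> v \<in> H j})"
    by (auto simp: less_Suc_eq)
  then show ?thesis by (simp add: degree_def)
qed

lemma chain_extend:
  assumes "chain r n m H e" "X \<subseteq> {..<n}" "card X = r" "e m \<subseteq> X" "f \<subseteq> X - e m" "card f = 2"
    and "\<And>u v. \<lbrakk>u \<in> X; v \<in> X; u \<noteq> v; {u, v} \<noteq> e m\<rbrakk> \<Longrightarrow> \<not> linked H m u v"
  shows "chain r n (Suc m) (H(m := X)) (e(Suc m := f))"
proof -
  interpret chain r n m H e by fact
  show ?thesis
  proof
    fix i assume i: "i < Suc m"
    show "(H(m := X)) i \<subseteq> {..<n}" using i H_subset[of i] assms(2) by auto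
    show "card ((H(m := X)) i) = r" using i card_H[of i] assms(3) by auto
    show "(e(Suc m := f)) i \<subseteq> (H(m := X)) i" using i e_subset[of i] assms(4) by auto
    show "(e(Suc m := f)) (Suc i) \<subseteq> (H(m := X)) i" using i e_Suc_subset[of i] assms(5) by auto
    show "(e(Suc m := f)) i \<inter> (e(Suc m := f)) (Suc i) = {}"
      using i e_disjoint[of i] assms(5) by auto
    fix u v assume "u \<in> (H(m := X)) i" "v \<in> (H(m := X)) i" "u \<noteq> v" "{u, v} \<noteq> (e(Suc m := f)) i"
    moreover have "linked (H(m := X)) i = linked H i" using i by (simp add: linked_fun_upd)
    ultimately show "\<not> linked (H(m := X)) i u v"
      using i unlinked[of i u v] assms(7)[of u v] by (cases "i = m") simp_all
  next
    fix i assume "i \<le> Suc m"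
    then show "card ((e(Suc m := f)) i) = 2" using card_e[of i] assms(6) by auto
  qed
qed

text \<open>Only vertices of degree less than \<open>D\<close> are chosen; such a vertex can occur once more, as an
  element of the current last edge, so degrees never exceed \<open>D + 1\<close>.\<close>

lemma greedy_chain:
  assumes "4 \<le> r" "0 < D" "m * r \<le> D * N" "N + r + r * (Suc D * (r * (Suc D * r))) < n"
  shows "\<exists>H e. chain r n m H e \<and> e m \<subseteq> {..<n} \<and>
    (\<forall>v. degree H m v \<le> Suc D) \<and> (\<forall>v\<in>e m. degree H m v \<le> D)"
  using assms(3)
proof (induction m)
  case 0
  have "chain r n 0 H (\<lambda>_. {0, 1})" for H by unfold_locales auto
  moreover have "{0, 1} \<subseteq> {..<n}" using assms(1,4) by auto
  ultimately show ?case by (intro exI[of _ "\<lambda>_. {}"] exI[of _ "\<lambda>_. {0, 1}"]) (simp add: degree_def)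
next
  case (Suc m)
  then have mr: "m * r \<le> D * N" by simp
  then obtain H e where H: "chain r n m H e" "e m \<subseteq> {..<n}" "\<And>v. degree H m v \<le> Suc D"
    and end_degree: "\<And>v. v \<in> e m \<Longrightarrow> degree H m v \<le> D"
    using Suc.IH by blast
  interpret chain r n m H e by fact
  have "r - 2 + 2 \<le> r" using assms(1) by simp
  obtain Y where Y: "Y \<subseteq> {..<n}" "card Y = r - 2" "e m \<inter> Y = {}" "\<forall>y\<in>Y. degree H m y < D"
    and free: "\<forall>u\<in>e m \<union> Y. \<forall>v\<in>e m \<union> Y. u \<noteq> v \<longrightarrow> {u, v} \<noteq> e m \<longrightarrow> \<not> linked H m u v"
    using greedy_vertices[OF H assms(2) mr assms(4) \<open>r - 2 + 2 \<le> r\<close>] by (elim exE conjE) (rule that)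
  \<comment> \<open>The next gluing edge is taken among the new vertices: it is then disjoint from
    \<open>e m\<close>, and its ends can still take part in one more clique.\<close>
  have "2 \<le> card Y" using Y(2) assms(1) by simp
  then obtain f where f: "f \<subseteq> Y" "card f = 2" using obtain_subset_with_card_n by metis
  let ?X = "e m \<union> Y"
  have fin: "finite Y" "finite (e m)" using Y(1) H(2) finite_subset by blast+
  have "card ?X = r" using Y(2,3) fin card_e[of m] assms(1) by (simp add: card_Un_disjoint)
  then have "chain r n (Suc m) (H(m := ?X)) (e(Suc m := f))"
    using H(1,2) Y(1,3) f free by (intro chain_extend) auto
  moreover have "degree (H(m := ?X)) (Suc m) v \<le> Suc D" for v
    using H(3)[of v] end_degree[of v] Y(4) by (auto simp: degree_fun_upd)
  moreover have "degree (H(m := ?X)) (Suc m) v \<le> D" if "v \<in> f" for v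
  proof -
    have "v \<in> Y" using that f(1) by blast
    then show ?thesis using Y(4) by (simp add: degree_fun_upd Suc_leI)
  qed
  moreover have "f \<subseteq> {..<n}" using f(1) Y(1) by blast
  ultimately have "chain r n (Suc m) (H(m := ?X)) (e(Suc m := f)) \<and>
      (e(Suc m := f)) (Suc m) \<subseteq> {..<n} \<and>
      (\<forall>v. degree (H(m := ?X)) (Suc m) v \<le> Suc D) \<and>
      (\<forall>v\<in>(e(Suc m := f)) (Suc m). degree (H(m := ?X)) (Suc m) v \<le> D)"
    by (simp del: fun_upd_apply add: fun_upd_same)
  then show ?case by blast
qed

lemma le_tau_max_greedy:
  assumes "5 \<le> r" "0 < D" "m * r \<le> D * N" "N + r + r * (Suc D * (r * (Suc D * r))) < n"
  shows "m \<le> tau_max n r"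
proof -
  obtain H e where "chain r n m H e" using greedy_chain[of r D m N n] assms by auto
  then show ?thesis using chain.le_tau_max[of r n m H e] assms(1) by blast
qed

section \<open>Choice of parameters\<close>

text \<open>With \<open>D\<close> about \<open>y = sqrt n / (2 r^2)\<close> the excluded
  neighbourhoods have total size at most \<open>r^3 y^2 = n / (4 r)\<close>, at most
  \<open>n / 20\<close>, which fits beside \<open>N\<close>, about \<open>n / 2\<close>. The bound
  \<open>64 * r ^ 4\<close> yields \<open>y \<ge> 4\<close>, so rounding costs at most half of
  \<open>y\<close>.\<close>

lemma tau_max_lower_bound:
  assumes "5 \<le> r" "64 * r ^ 4 \<le> n"
  shows "1 / (24 * real r ^ 3) * real n powr (3/2) \<le> real (tau_max n r)"
proof -
  define x where "x = sqrt (real n)"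
  define y where "y = x / (2 * real r ^ 2)"
  \<comment> \<open>Degrees reach \<open>Suc D\<close>, so it is \<open>Suc D\<close> that must stay
    below \<open>y\<close>.\<close>
  define D where "D = nat \<lfloor>y\<rfloor> - 1"
  define N where "N = n div 2"
  define m where "m = D * N div r"
  have r: "5 \<le> real r" using assms(1) by simp
  have r2: "25 \<le> real r ^ 2" using power_mono[OF r, of 2] by simp
  have r3: "125 \<le> real r ^ 3" using power_mono[OF r, of 3] by simp
  have xn: "x * x = real n" "x ^ 2 = real n" "0 \<le> x" by (simp_all add: x_def)
  have "real (64 * r ^ 4) \<le> real n" using assms(2) by (simp only: of_nat_le_iff)
  then have "(8 * real r ^ 2) ^ 2 \<le> x ^ 2" unfolding xn by (simp add: power_mult_distrib flip: power_mult)
  then have x: "8 * real r ^ 2 \<le> x" using xn(3) by (rule power2_le_imp_le)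
  have y: "4 \<le> y" unfolding y_def using x r by (simp add: field_simps)
  have "real (Suc D) = of_int \<lfloor>y\<rfloor>" unfolding D_def using y by linarith
  then have D: "real (Suc D) \<le> y" "y - 2 \<le> real D" by linarith+
  have "0 < D" using D(2) y by linarith
  moreover have "m * r \<le> D * N" by (simp add: m_def)
  moreover have "N + r + r * (Suc D * (r * (Suc D * r))) < n"
  proof -
    have "real (Suc D) * real (Suc D) \<le> y * y" using D(1) y by (intro mult_mono) auto
    then have "real r ^ 3 * (real (Suc D) * real (Suc D)) \<le> real r ^ 3 * (y * y)"
      by (rule mult_left_mono) simp
    also have "\<dots> = real n / (4 * real r)"
      using r xn(1) by (simp add: y_def field_simps power2_eq_square power3_eq_cube)
    also have "\<dots> \<le> real n / 20" using r by (intro divide_left_mono) auto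
    also have "real r ^ 3 * (real (Suc D) * real (Suc D)) = real (r * (Suc D * (r * (Suc D * r))))"
      by (simp only: power3_eq_cube of_nat_mult mult_ac)
    finally have "real (r * (Suc D * (r * (Suc D * r)))) \<le> real n / 20" .
    moreover have "40 * real r \<le> real n"
    proof -
      have "40 * real r \<le> 64 * (real r * 125)" by simp
      also have "\<dots> \<le> 64 * (real r * real r ^ 3)" using r3 r by (intro mult_left_mono) auto
      also have "\<dots> \<le> real n" using \<open>real (64 * r ^ 4) \<le> real n\<close> by (simp add: eval_nat_numeral)
      finally show ?thesis .
    qed
    moreover have "real N \<le> real n / 2" unfolding N_def by linarith
    ultimately have "real (N + r + r * (Suc D * (r * (Suc D * r)))) < real n"
      using r by (simp only: of_nat_add)
    then show ?thesis by (simp only: of_nat_less_iff)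
  qed
  ultimately have "m \<le> tau_max n r" by (rule le_tau_max_greedy[OF assms(1)])
  moreover have "1 / (24 * real r ^ 3) * real n powr (3/2) \<le> real m"
  proof -
    have x40: "200 \<le> x" using x r2 by linarith
    have n: "real n \<ge> 40000" using mult_mono[OF x40 x40] xn by simp
    have "real n powr (3/2) = real n powr (1 + 1/2)" by simp
    also have "\<dots> = real n * x" using n by (subst powr_add) (simp add: x_def powr_half_sqrt)
    finally have powr: "real n powr (3/2) = real n * x" .
    have D': "y / 2 \<le> real D" using D(2) y by linarith
    have N': "real n / 3 \<le> real N" unfolding N_def using n by linarith
    have "y / 2 * (real n / 3) \<le> real D * real N" using D' N' y by (intro mult_mono) auto
    then have "y / 2 * (real n / 3) / real r \<le> real (D * N) / real r"
      using r by (intro divide_right_mono) auto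
    moreover have "\<lfloor>real (D * N) / real r\<rfloor> = int m"
      by (simp only: m_def floor_divide_of_nat_eq)
    then have "real (D * N) / real r - 1 \<le> real m" by linarith
    moreover have "y / 2 * (real n / 3) / real r = 2 * (1 / (24 * real r ^ 3) * (real n * x))"
      using r by (simp add: y_def field_simps power2_eq_square power3_eq_cube)
    \<comment> \<open>The main term is twice the claimed bound; one copy absorbs the loss of at most
      \<open>1\<close> from the integer division in \<open>m\<close>.\<close>
    moreover have "1 \<le> 1 / (24 * real r ^ 3) * (real n * x)"
    proof -
      have "real r ^ 3 \<le> real r ^ 4" using r by (intro power_increasing) auto
      then have "24 * real r ^ 3 \<le> 64 * real r ^ 4" using r3 by linarith
      also have "\<dots> \<le> real n" using \<open>real (64 * r ^ 4) \<le> real n\<close> by simp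
      also have "\<dots> * 1 \<le> real n * x" using x40 n by (intro mult_left_mono) auto
      finally show ?thesis using r by (simp add: field_simps)
    qed
    ultimately show ?thesis unfolding powr by linarith
  qed
  ultimately show ?thesis by linarith
qed

theorem theorem1:
  shows "(\<forall>n::nat. n \<ge> 2 \<longrightarrow> int (tau_max n 3) = \<lceil>log 2 (real n - 1)\<rceil>)
       \<and> (\<forall>n::nat. n \<ge> 3 \<longrightarrow> tau_max n 4 = n - 3)
       \<and> (\<forall>r::nat. r \<ge> 5 \<longrightarrow> (\<exists>c::real. c > 0 \<and> (\<exists>n0::nat. \<forall>n \<ge> n0.
            real (tau_max n r) \<ge> c * real n powr (3/2))))"
proof (intro conjI allI impI)
  fix r :: nat assume r: "5 \<le> r"
  show "\<exists>c::real. c > 0 \<and> (\<exists>n0::nat. \<forall>n \<ge> n0.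
            real (tau_max n r) \<ge> c * real n powr (3/2))"
    using tau_max_lower_bound[OF r] r
    by (intro exI[of _ "1 / (24 * real r ^ 3)"] conjI exI[of _ "64 * r ^ 4"]) auto
qed (use tau_max_3_eq tau_max_4_eq in auto)

end
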